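(* Let $p\ge 1$ and let $n,n_1,\dots,n_p$ be integers with $0<n_p<\cdots<n_1<n$. Let $Z$ be the principal solution of $Z^n+x_1Z^{n_1}+\cdots+x_pZ^{n_p}-1=0$. Let $\alpha>0$, let $u_1,\dots,u_p$ be complex numbers, and set $u := \frac{\alpha}{n}-\frac{n_1}{n}u_1-\cdots-\frac{n_p}{n}u_p$. If the real parts of $u,u_1,\dots,u_p$ are all positive, then $$\int_0^\infty\cdots\int_0^\infty Z(x_1,\dots,x_p)^\alpha\, x_1^{u_1-1}\cdots x_p^{u_p-1}\,dx_1\cdots dx_p = \frac{\alpha}{n}\,\frac{\Gamma(u)\Gamma(u_1)\cdots\Gamma(u_p)}{\Gamma(u+u_1+\cdots+u_p+1)}.$$
   Context: A principal solution is an analytic function $Z(x_1,\dots,x_p)$ on $[0,\infty)^p$ (near each point of $[0,\infty)^p$ given by a convergent power series) satisfying $Z^n + x_1 Z^{n_1}+\cdots+x_pZ^{n_p}-1=0$ for all $(x_1,\dots,x_p)\in[0,\infty)^p$ and $Z(0,\dots,0)=1$. The principal solution exists, is unique, and takes positive real values, so $Z^\alpha$ denotes the usual positive real power. $\Gamma$ is Euler's Gamma function. *)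

theory Defs
  imports "HOL-Analysis.Analysis"
begin

text \<open>
  A point \<open>(x\<^sub>1, \<dots>, x\<^sub>p)\<close> is an extensional function on \<open>{1..p}\<close>, as in the carrier of
  \<open>Pi\<^sub>M {1..p} (\<lambda>_. lborel)\<close>.
\<close>

definition real_space :: "nat \<Rightarrow> (nat \<Rightarrow> real) set" where
  "real_space p = {1..p} \<rightarrow>\<^sub>E UNIV"

definition orthant :: "nat \<Rightarrow> (nat \<Rightarrow> real) set" where
  "orthant p = {1..p} \<rightarrow>\<^sub>E {0..}"

definition multi_indices :: "nat \<Rightarrow> (nat \<Rightarrow> nat) set" where
  "multi_indices p = {1..p} \<rightarrow>\<^sub>E UNIV"

text \<open>
  At a boundary point of the orthant the power series is required to converge on a full
  neighbourhood; it represents \<open>f\<close> on the part of that neighbourhood lying in the orthant.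
\<close>

definition analytic_on_orthant :: "nat \<Rightarrow> ((nat \<Rightarrow> real) \<Rightarrow> complex) \<Rightarrow> bool" where
  "analytic_on_orthant p f \<longleftrightarrow>
     (\<forall>a\<in>orthant p. \<exists>(c :: (nat \<Rightarrow> nat) \<Rightarrow> complex) (r :: real). r > 0 \<and>
        (\<forall>x\<in>real_space p. (\<forall>i\<in>{1..p}. \<bar>x i - a i\<bar> < r) \<longrightarrow>
           (\<lambda>m. c m * (\<Prod>i=1..p. of_real (x i - a i) ^ m i)) summable_on multi_indices p \<and>
           (x \<in> orthant p \<longrightarrow>
              ((\<lambda>m. c m * (\<Prod>i=1..p. of_real (x i - a i) ^ m i)) has_sum f x)
                (multi_indices p))))"

text \<open>
  A principal solution is a priori allowed to be complex-valued; that its values are positive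
  reals is a consequence of the definition and is not built into it.
\<close>

definition principal_solution ::
    "nat \<Rightarrow> nat \<Rightarrow> (nat \<Rightarrow> nat) \<Rightarrow> ((nat \<Rightarrow> real) \<Rightarrow> complex) \<Rightarrow> bool" where
  "principal_solution p n ns Z \<longleftrightarrow>
     analytic_on_orthant p Z \<and>
     (\<forall>x\<in>orthant p. Z x ^ n + (\<Sum>i=1..p. of_real (x i) * Z x ^ ns i) - 1 = 0) \<and>
     Z (\<lambda>i\<in>{1..p}. 0) = 1"

end

theory Submission
  imports Defs
begin

text \<open>
  Write \<open>\<beta> = \<alpha> / n\<close>. Only one fact about \<open>Z\<close> matters: its value at a point \<open>x\<close> of the orthant is the
  unique positive root of an increasing function, so that for \<open>w > 0\<close>
  \<open>w < Z(x)^n\<close> holds exactly when \<open>w + \<Sum> x\<^sub>i w^(n\<^sub>i/n) < 1\<close>.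
  The layer-cake formula \<open>b^\<beta> = \<beta> \<integral> w^(\<beta>-1) dw\<close> (over \<open>0 < w < b\<close>) at \<open>b = Z(x)^n\<close> therefore expresses \<open>Z(x)^\<alpha>\<close> as an
  integral in which \<open>Z\<close> occurs no more, and whose domain is, for each fixed \<open>w\<close>, a simplex in \<open>x\<close>.
  This replaces a change of variables with its Jacobian.

  Integrating over \<open>x\<close> first and rescaling \<open>x\<^sub>i = y\<^sub>i w^(-n\<^sub>i/n)\<close> turns the exponent \<open>\<beta> - 1\<close> of \<open>w\<close> into
  \<open>u\<^sub>0 - 1\<close> with \<open>u\<^sub>0 = \<beta> - \<Sum> (n\<^sub>i/n) u\<^sub>i\<close>. What remains is the Dirichlet integral of
  \<open>w^(u\<^sub>0-1) \<Prod> y\<^sub>i^(u\<^sub>i-1)\<close> over the simplex \<open>w + \<Sum> y\<^sub>i < 1\<close> in one dimension more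
  (\<open>simplex_fibration\<close>, \<open>has_bochner_integral_layers\<close>). Its value comes from the Laplace
  transform in \<open>v\<close> of the monomial integral over the simplex \<open>\<Sum> y\<^sub>i < v\<close>: on the one hand that
  integral is homogeneous in \<open>v\<close>, which gives a Gamma factor; on the other hand Fubini turns the transform into
  a product of one-dimensional Gamma integrals (\<open>integral_unit_simplex_monomial\<close>).

  Fubini needs absolute integrability. The modulus of each integrand is the same integrand with every
  exponent replaced by its real part, so most of these conditions are instances of the formulas
  themselves; the rest follow by domination by Gamma integrands.

  That \<open>Z(x)\<close> is a positive real is proved by continuation along the ray from the origin to \<open>x\<close>
  (\<open>principal_solution_positive_root\<close>).
\<close>

section \<open>Scaling coordinates in a product of Lebesgue measures\<close>

lemma product_sigma_finite_lborel: "product_sigma_finite (\<lambda>_. lborel :: real measure)"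
  by (simp add: product_sigma_finite_def sigma_finite_lborel)

text \<open>
  A diagonal linear map multiplies volume by the product of its entries; it is enough to check this
  on boxes.
\<close>

lemma PiM_lborel_scale:
  fixes c :: "'i \<Rightarrow> real"
  assumes fin: "finite I" and c: "\<And>i. i \<in> I \<Longrightarrow> 0 < c i"
  shows "density (distr (Pi\<^sub>M I (\<lambda>_. lborel)) (Pi\<^sub>M I (\<lambda>_. lborel)) (\<lambda>x. \<lambda>i\<in>I. c i * x i))
           (\<lambda>_. ennreal (\<Prod>i\<in>I. c i)) = Pi\<^sub>M I (\<lambda>_. lborel)"
proof -
  interpret product_sigma_finite "\<lambda>_::'i. lborel :: real measure"
    by (rule product_sigma_finite_lborel)
  let ?M = "Pi\<^sub>M I (\<lambda>_. lborel :: real measure)"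
  let ?T = "\<lambda>x. \<lambda>i\<in>I. c i * x i"
  have T: "?T \<in> ?M \<rightarrow>\<^sub>M ?M" by measurable
  show ?thesis
  proof (rule PiM_eqI[OF fin])
    fix A :: "'i \<Rightarrow> real set"
    assume "\<And>i. i \<in> I \<Longrightarrow> A i \<in> sets lborel"
    hence A: "A i \<in> sets borel" if "i \<in> I" for i using that by simp
    have vA: "(*) (c i) -` A i \<in> sets borel" if "i \<in> I" for i
      using measurable_sets_borel[of "(*) (c i)" borel "A i"] A[OF that] by simp
    have AM: "Pi\<^sub>E I A \<in> sets ?M" by (intro sets_PiM_I_finite fin) (simp add: A)
    have one: "ennreal (c i) * emeasure lborel ((*) (c i) -` A i) = emeasure lborel (A i)"
      if i: "i \<in> I" for i
    proof -
      have "emeasure lborel ((*) (c i) -` A i) = emeasure (distr lborel borel ((*) (c i))) (A i)"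
        using A[OF i] by (subst emeasure_distr) auto
      also have "\<dots> = ennreal (inverse (c i)) * emeasure lborel (A i)"
        using c[OF i] A[OF i] by (subst lborel_distr_mult) (auto simp: emeasure_density_const)
      finally show ?thesis
        using c[OF i] by (simp add: mult.assoc[symmetric] ennreal_mult'[symmetric])
    qed
    have pre: "?T -` Pi\<^sub>E I A \<inter> space ?M = Pi\<^sub>E I (\<lambda>i. (*) (c i) -` A i)"
      by (auto simp: space_PiM PiE_def Pi_def extensional_def)
    have "emeasure (density (distr ?M ?M ?T) (\<lambda>_. ennreal (\<Prod>i\<in>I. c i))) (Pi\<^sub>E I A)
        = ennreal (\<Prod>i\<in>I. c i) * emeasure ?M (Pi\<^sub>E I (\<lambda>i. (*) (c i) -` A i))"
      using AM T by (simp add: emeasure_density_const emeasure_distr pre)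
    also have "emeasure ?M (Pi\<^sub>E I (\<lambda>i. (*) (c i) -` A i))
        = (\<Prod>i\<in>I. emeasure lborel ((*) (c i) -` A i))"
      by (rule emeasure_PiM[OF fin]) (simp add: vA)
    also have "ennreal (\<Prod>i\<in>I. c i) * \<dots> = (\<Prod>i\<in>I. emeasure lborel (A i))"
      using c by (simp add: prod_ennreal[symmetric] less_imp_le prod.distrib[symmetric] one)
    finally show "emeasure (density (distr ?M ?M ?T) (\<lambda>_. ennreal (\<Prod>i\<in>I. c i))) (Pi\<^sub>E I A)
        = (\<Prod>i\<in>I. emeasure lborel (A i))" .
  qed simp
qed

lemma has_bochner_integral_PiM_scale:
  fixes c :: "'i \<Rightarrow> real" and f :: "('i \<Rightarrow> real) \<Rightarrow> 'b::{banach, second_countable_topology}"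
  assumes fin: "finite I" and c: "\<And>i. i \<in> I \<Longrightarrow> 0 < c i"
    and f: "has_bochner_integral (Pi\<^sub>M I (\<lambda>_. lborel)) f L"
  shows "has_bochner_integral (Pi\<^sub>M I (\<lambda>_. lborel)) (\<lambda>x. f (\<lambda>i\<in>I. c i * x i))
           (inverse (\<Prod>i\<in>I. c i) *\<^sub>R L)"
proof -
  let ?M = "Pi\<^sub>M I (\<lambda>_. lborel :: real measure)"
  let ?T = "\<lambda>x. \<lambda>i\<in>I. c i * x i"
  let ?K = "\<Prod>i\<in>I. c i"
  have K: "?K > 0" by (intro prod_pos) (simp add: c)
  have T: "?T \<in> ?M \<rightarrow>\<^sub>M ?M" by measurable
  have fm[measurable]: "f \<in> borel_measurable ?M" using f by (rule borel_measurable_has_bochner_integral)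
  have "has_bochner_integral (density (distr ?M ?M ?T) (\<lambda>_. ennreal ?K)) f L"
    using f by (subst PiM_lborel_scale[OF fin c])
  hence "has_bochner_integral (distr ?M ?M ?T) (\<lambda>x. ?K *\<^sub>R f x) L"
    using K by (simp add: has_bochner_integral_iff integrable_density integral_density)
  hence "has_bochner_integral (distr ?M ?M ?T) (\<lambda>x. inverse ?K *\<^sub>R ?K *\<^sub>R f x) (inverse ?K *\<^sub>R L)"
    by (rule has_bochner_integral_scaleR_right)
  hence "has_bochner_integral (distr ?M ?M ?T) f (inverse ?K *\<^sub>R L)"
    using K by simp
  thus ?thesis
    using T by (simp add: has_bochner_integral_iff integrable_distr_eq integral_distr)
qed

section \<open>Power functions on the half-line\<close>

text \<open>
  The Mellin kernel, extended by zero. Building the positivity of the variable into the function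
  keeps domains of integration out of all later statements.
\<close>

definition mellin_power :: "complex \<Rightarrow> real \<Rightarrow> complex" where
  "mellin_power z x = (if 0 < x then of_real x powr (z - 1) else 0)"

lemma mellin_power_exp:
  "mellin_power z x = (if 0 < x then exp ((z - 1) * of_real (ln x)) else 0)"
  by (auto simp: mellin_power_def powr_def Ln_of_real)

lemma measurable_mellin_power[measurable]: "mellin_power z \<in> borel_measurable borel"
  unfolding mellin_power_exp[abs_def] by measurable

text \<open>
  Stated with the modulus read as a complex number, so that formulas for complex exponents yield
  formulas for the integrals of the moduli by substituting real parts.
\<close>

lemma norm_mellin_power:
  "complex_of_real (norm (mellin_power z x)) = mellin_power (of_real (Re z)) x"
  by (auto simp: mellin_power_exp exp_of_real[symmetric] simp del: exp_of_real)

lemma mellin_power_mult: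
  "0 < c \<Longrightarrow> mellin_power z (c * x) = of_real c powr (z - 1) * mellin_power z x"
  by (auto simp: mellin_power_exp powr_def Ln_of_real ln_mult exp_add[symmetric] algebra_simps
        zero_less_mult_iff)

text \<open>
  Passes from gauge integrals on a set to Lebesgue integrals on the line; the exceptional null set
  absorbs the difference between open and closed intervals.
\<close>

lemma has_bochner_integral_lborel_from_has_integral:
  fixes f g :: "real \<Rightarrow> 'b::euclidean_space"
  assumes f: "f absolutely_integrable_on S" "(f has_integral L) S"
    and g: "g \<in> borel_measurable borel" and eq: "AE x in lborel. g x = (if x \<in> S then f x else 0)"
  shows "has_bochner_integral lborel g L"
proof -
  let ?f = "\<lambda>x. indicat_real S x *\<^sub>R f x"
  have i: "integrable lebesgue ?f" using f(1) by (simp add: set_integrable_def)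
  have "integral\<^sup>L lebesgue ?f = L"
    using set_lebesgue_integral_eq_integral(2)[OF f(1)] integral_unique[OF f(2)]
    by (simp add: set_lebesgue_integral_def)
  with i have "has_bochner_integral lebesgue ?f L" by (simp add: has_bochner_integral_iff)
  moreover have "AE x in lebesgue. g x = ?f x"
    by (rule AE_completion, use eq in eventually_elim) (auto simp: indicator_def)
  moreover have "g \<in> borel_measurable lebesgue" using g by (intro measurable_completion) simp
  ultimately have "has_bochner_integral lebesgue g L"
    using i by (subst has_bochner_integral_cong_AE[of _ _ ?f]) auto
  thus ?thesis using g by (simp add: has_bochner_integral_iff integrable_completion integral_completion)
qed

lemma has_bochner_integral_Gamma:
  assumes "Re z > 0"
  shows "has_bochner_integral lborel (\<lambda>x. mellin_power z x * of_real (exp (- x))) (Gamma z)"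
proof (rule has_bochner_integral_lborel_from_has_integral
    [OF absolutely_integrable_Gamma_integral'[OF assms] Gamma_integral_complex'[OF assms]])
  show "(\<lambda>x. mellin_power z x * of_real (exp (- x))) \<in> borel_measurable borel" by measurable
qed (auto simp: mellin_power_def exp_minus field_simps)

lemma has_bochner_integral_exp_tail:
  "has_bochner_integral lborel (\<lambda>v. if s < v then exp (- v) else 0 :: real) (exp (- s))"
proof (rule has_bochner_integral_lborel_from_has_integral)
  show *: "((\<lambda>v. exp (- v)) has_integral exp (- s)) {s..}"
    using has_integral_exp_minus_to_infinity[of 1 s] by simp
  show "(\<lambda>v. exp (- v) :: real) absolutely_integrable_on {s..}"
    using * by (intro nonnegative_absolutely_integrable_1) (auto simp: integrable_on_def)
  show "AE v in lborel. (if s < v then exp (- v) else 0) = (if v \<in> {s..} then exp (- v) else 0)"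
    using AE_lborel_singleton[of s] by eventually_elim auto
qed measurable

text \<open>
  The layer-cake formula that removes the solution from the integrand, applied with \<open>b\<close> the \<open>n\<close>-th
  power of its value.
\<close>

lemma has_bochner_integral_mellin_power_cutoff:
  assumes "\<beta> > 0" "b \<ge> 0"
  shows "has_bochner_integral lborel (\<lambda>w. if w < b then mellin_power (of_real \<beta>) w else 0)
           (of_real (b powr \<beta> / \<beta>))"
proof -
  have "has_bochner_integral lborel (\<lambda>w. if 0 < w \<and> w < b then w powr (\<beta> - 1) else 0) (b powr \<beta> / \<beta>)"
  proof (rule has_bochner_integral_lborel_from_has_integral)
    show *: "((\<lambda>w. w powr (\<beta> - 1)) has_integral b powr \<beta> / \<beta>) {0..b}"
      using has_integral_powr_from_0[of "\<beta> - 1" b] assms by simp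
    show "(\<lambda>w. w powr (\<beta> - 1)) absolutely_integrable_on {0..b}"
      using * by (intro nonnegative_absolutely_integrable_1) (auto simp: integrable_on_def)
    show "AE w in lborel. (if 0 < w \<and> w < b then w powr (\<beta> - 1) else 0)
        = (if w \<in> {0..b} then w powr (\<beta> - 1) else 0)"
      using AE_lborel_singleton[of b] by eventually_elim auto
  qed measurable
  hence "has_bochner_integral lborel
      (\<lambda>w. complex_of_real (if 0 < w \<and> w < b then w powr (\<beta> - 1) else 0)) (of_real (b powr \<beta> / \<beta>))"
    by (rule has_bochner_integral_of_real)
  moreover have "(\<lambda>w. complex_of_real (if 0 < w \<and> w < b then w powr (\<beta> - 1) else 0))
      = (\<lambda>w. if w < b then mellin_power (of_real \<beta>) w else 0)"
    by (auto simp: mellin_power_def powr_of_real[symmetric])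
  ultimately show ?thesis by simp
qed

section \<open>The Dirichlet integral over a simplex\<close>

definition mellin_monomial :: "'i set \<Rightarrow> ('i \<Rightarrow> complex) \<Rightarrow> ('i \<Rightarrow> real) \<Rightarrow> complex" where
  "mellin_monomial I u x = (\<Prod>i\<in>I. mellin_power (u i) (x i))"

lemma measurable_mellin_monomial[measurable]:
  "mellin_monomial I u \<in> borel_measurable (Pi\<^sub>M I (\<lambda>_. lborel))"
  unfolding mellin_monomial_def[abs_def] by measurable

lemma mellin_monomial_eq_0:
  "finite I \<Longrightarrow> i \<in> I \<Longrightarrow> x i \<le> 0 \<Longrightarrow> mellin_monomial I u x = 0"
  unfolding mellin_monomial_def by (rule prod_zero) (force simp: mellin_power_def)+

lemma norm_mellin_monomial:
  "complex_of_real (norm (mellin_monomial I u x)) = mellin_monomial I (\<lambda>i. of_real (Re (u i))) x"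
  by (simp add: mellin_monomial_def norm_mellin_power prod_norm[symmetric])

lemma has_bochner_integral_Gamma_prod:
  assumes "finite I" "\<And>i. i \<in> I \<Longrightarrow> Re (u i) > 0"
  shows "has_bochner_integral (Pi\<^sub>M I (\<lambda>_. lborel))
           (\<lambda>x. mellin_monomial I u x * of_real (exp (- (\<Sum>i\<in>I. x i)))) (\<Prod>i\<in>I. Gamma (u i))"
proof -
  interpret product_sigma_finite "\<lambda>_::'a. lborel :: real measure"
    by (rule product_sigma_finite_lborel)
  let ?f = "\<lambda>i x. mellin_power (u i) x * of_real (exp (- x))"
  have i: "integrable lborel (?f i)" "integral\<^sup>L lborel (?f i) = Gamma (u i)" if "i \<in> I" for i
    using has_bochner_integral_Gamma[OF assms(2)[OF that]] by (auto simp: has_bochner_integral_iff)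
  have eq: "(\<lambda>x. mellin_monomial I u x * of_real (exp (- (\<Sum>i\<in>I. x i)))) = (\<lambda>x. \<Prod>i\<in>I. ?f i (x i))"
    using assms(1) by (auto simp: mellin_monomial_def prod.distrib exp_sum sum_negf[symmetric])
  show ?thesis
    unfolding eq has_bochner_integral_iff
    using product_integrable_prod[of I ?f] product_integral_prod[of I ?f] assms(1) i by simp
qed

definition simplex_monomial :: "'i set \<Rightarrow> ('i \<Rightarrow> complex) \<Rightarrow> real \<Rightarrow> ('i \<Rightarrow> real) \<Rightarrow> complex" where
  "simplex_monomial I u t x = (if (\<Sum>i\<in>I. x i) < t then mellin_monomial I u x else 0)"

lemma measurable_simplex_monomial[measurable]:
  "simplex_monomial I u t \<in> borel_measurable (Pi\<^sub>M I (\<lambda>_. lborel))"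
  unfolding simplex_monomial_def[abs_def] by measurable

lemma simplex_monomial_nonpos:
  assumes "finite I" "t \<le> 0"
  shows "simplex_monomial I u t x = 0"
proof (cases "\<exists>i\<in>I. x i \<le> 0")
  case True
  then show ?thesis using mellin_monomial_eq_0[OF assms(1)] by (auto simp: simplex_monomial_def)
next
  case False
  hence "(\<Sum>i\<in>I. x i) \<ge> 0" by (intro sum_nonneg) force
  with assms show ?thesis by (simp add: simplex_monomial_def)
qed

text \<open>
  On the simplex the factor \<open>exp (t - \<Sum> x\<^sub>i)\<close> is at least 1, so \<open>exp t\<close> times a product of
  Gamma integrands dominates.
\<close>

lemma integrable_simplex_monomial:
  assumes "finite I" "\<And>i. i \<in> I \<Longrightarrow> Re (u i) > 0"
  shows "integrable (Pi\<^sub>M I (\<lambda>_. lborel)) (simplex_monomial I u t)"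
proof (rule Bochner_Integration.integrable_bound)
  show "integrable (Pi\<^sub>M I (\<lambda>_. lborel))
      (\<lambda>x. of_real (exp t) * (mellin_monomial I u x * of_real (exp (- (\<Sum>i\<in>I. x i)))))"
    using has_bochner_integral_Gamma_prod[where I = I and u = u, OF assms] by (auto simp: has_bochner_integral_iff)
  have "norm (simplex_monomial I u t x)
      \<le> norm (of_real (exp t) * (mellin_monomial I u x * of_real (exp (- (\<Sum>i\<in>I. x i)))))" for x
    by (auto simp: simplex_monomial_def norm_mult mult_le_cancel_left1 exp_add[symmetric]
        mult.left_commute[of _ "norm _"] simp flip: exp_diff)
  thus "AE x in Pi\<^sub>M I (\<lambda>_. lborel). norm (simplex_monomial I u t x)
      \<le> norm (of_real (exp t) * (mellin_monomial I u x * of_real (exp (- (\<Sum>i\<in>I. x i)))))"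
    by simp
qed measurable

text \<open>
  Used twice: with all \<open>c i\<close> equal it gives the homogeneity of the simplex integral, and with
  \<open>c i\<close> a power of \<open>w\<close> it evaluates the slices of the region below the graph of
  \<open>Z^n\<close>.
\<close>

lemma has_bochner_integral_scaled_simplex:
  assumes fin: "finite I" and u: "\<And>i. i \<in> I \<Longrightarrow> Re (u i) > 0" and c: "\<And>i. i \<in> I \<Longrightarrow> 0 < c i"
  shows "has_bochner_integral (Pi\<^sub>M I (\<lambda>_. lborel))
           (\<lambda>x. if (\<Sum>i\<in>I. c i * x i) < t then mellin_monomial I u x else 0)
           ((\<Prod>i\<in>I. of_real (c i) powr (- u i)) * (LINT x|Pi\<^sub>M I (\<lambda>_. lborel). simplex_monomial I u t x))"
proof -
  let ?M = "Pi\<^sub>M I (\<lambda>_. lborel :: real measure)"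
  let ?D = "\<Prod>i\<in>I. of_real (c i) powr (u i - 1)"
  have D: "?D \<noteq> 0" using fin c by (force simp: powr_def)
  have "has_bochner_integral ?M (\<lambda>x. simplex_monomial I u t (\<lambda>i\<in>I. c i * x i))
      (inverse (\<Prod>i\<in>I. c i) *\<^sub>R (LINT x|?M. simplex_monomial I u t x))"
    by (intro has_bochner_integral_PiM_scale fin c has_bochner_integral_integrable
        integrable_simplex_monomial u)
  hence "has_bochner_integral ?M (\<lambda>x. inverse ?D * simplex_monomial I u t (\<lambda>i\<in>I. c i * x i))
      (inverse ?D * (inverse (\<Prod>i\<in>I. c i) *\<^sub>R (LINT x|?M. simplex_monomial I u t x)))"
    by (intro has_bochner_integral_mult_right)
  moreover have "inverse ?D * simplex_monomial I u t (\<lambda>i\<in>I. c i * x i)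
      = (if (\<Sum>i\<in>I. c i * x i) < t then mellin_monomial I u x else 0)" for x
  proof -
    have "mellin_monomial I u (\<lambda>i\<in>I. c i * x i) = ?D * mellin_monomial I u x"
      using c by (simp add: mellin_monomial_def mellin_power_mult prod.distrib)
    thus ?thesis using D by (simp add: simplex_monomial_def)
  qed
  moreover have "inverse ?D * (inverse (\<Prod>i\<in>I. c i) *\<^sub>R L)
      = (\<Prod>i\<in>I. of_real (c i) powr (- u i)) * L" for L
  proof -
    have "inverse (of_real (c i) powr (u i - 1)) * inverse (of_real (c i)) = of_real (c i) powr (- u i)"
      if "i \<in> I" for i
      using c[OF that] by (simp add: powr_diff powr_minus field_simps)
    hence "inverse ?D * inverse (\<Prod>i\<in>I. of_real (c i)) = (\<Prod>i\<in>I. of_real (c i) powr (- u i))"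
      by (simp add: prod_inversef[symmetric] prod.distrib[symmetric] o_def)
    thus ?thesis by (simp add: scaleR_conv_of_real mult.assoc[symmetric])
  qed
  ultimately show ?thesis by simp
qed

lemma integral_simplex_monomial_homogeneous:
  assumes fin: "finite I" and u: "\<And>i. i \<in> I \<Longrightarrow> Re (u i) > 0" and t: "0 < t"
  shows "(LINT x|Pi\<^sub>M I (\<lambda>_. lborel). simplex_monomial I u t x)
       = of_real t powr (\<Sum>i\<in>I. u i) * (LINT x|Pi\<^sub>M I (\<lambda>_. lborel). simplex_monomial I u 1 x)"
proof -
  have "(\<lambda>x. if (\<Sum>i\<in>I. inverse t * x i) < 1 then mellin_monomial I u x else 0) = simplex_monomial I u t"
    using t by (simp add: simplex_monomial_def[abs_def] sum_distrib_left[symmetric]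
        mult.commute[of "inverse t"] divide_inverse[symmetric] sum_divide_distrib[symmetric])
  moreover have "(\<Prod>i\<in>I. of_real (inverse t) powr (- u i)) = of_real t powr (\<Sum>i\<in>I. u i)"
  proof -
    have "of_real (inverse t) powr (- u i) = exp (u i * of_real (ln t))" for i
      using t Ln_of_real[of "inverse t"] by (simp add: powr_def ln_inverse)
    thus ?thesis using t fin by (simp add: powr_def exp_sum sum_distrib_right Ln_of_real)
  qed
  ultimately show ?thesis
    using has_bochner_integral_scaled_simplex[where I = I and u = u and c = "\<lambda>_. inverse t" and t = 1, OF fin u] t
    by (simp add: has_bochner_integral_iff)
qed

lemma pair_sigma_finite_PiM_lborel:
  assumes "finite I"
  shows "pair_sigma_finite (Pi\<^sub>M I (\<lambda>_. lborel :: real measure)) (lborel :: real measure)"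
    and "pair_sigma_finite (lborel :: real measure) (Pi\<^sub>M I (\<lambda>_. lborel :: real measure))"
  using product_sigma_finite.sigma_finite[OF product_sigma_finite_lborel assms] sigma_finite_lborel
  by (auto simp: pair_sigma_finite_def)

text \<open>
  Integrate \<open>exp (- v)\<close> times the monomial over all pairs with \<open>\<Sum> x\<^sub>i < v\<close>. Integrating over \<open>v\<close>
  first leaves \<open>exp (- \<Sum> x\<^sub>i)\<close>, hence a product of Gamma integrals; integrating over \<open>x\<close> first leaves
  the unit simplex integral times \<open>v\<close> to the power \<open>\<Sum> u\<^sub>i\<close>, hence a single Gamma factor.
\<close>

lemma integral_unit_simplex_monomial:
  assumes fin: "finite I" and u: "\<And>i. i \<in> I \<Longrightarrow> Re (u i) > 0"
  shows "(LINT x|Pi\<^sub>M I (\<lambda>_. lborel). simplex_monomial I u 1 x)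
       = (\<Prod>i\<in>I. Gamma (u i)) / Gamma ((\<Sum>i\<in>I. u i) + 1)"
proof -
  let ?M = "Pi\<^sub>M I (\<lambda>_. lborel :: real measure)"
  interpret pair_sigma_finite ?M "lborel :: real measure"
    by (rule pair_sigma_finite_PiM_lborel[OF fin])
  define F where "F x v = of_real (exp (- v)) * simplex_monomial I u v x" for x v
  define U where "U = (\<Sum>i\<in>I. u i)"
  define L where "L = (LINT x|?M. simplex_monomial I u 1 x)"
  have ReU: "Re (U + 1) > 0"
    using sum_nonneg[of I "\<lambda>i. Re (u i)"] u by (auto simp: U_def less_imp_le add_nonneg_pos)
  have F_eq: "F x v = of_real (if (\<Sum>i\<in>I. x i) < v then exp (- v) else 0) * mellin_monomial I u x" for x v
    by (auto simp: F_def simplex_monomial_def)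
  have F_meas[measurable]: "case_prod F \<in> borel_measurable (?M \<Otimes>\<^sub>M lborel)"
    unfolding F_eq[abs_def] case_prod_beta' by measurable
  have Fv: "has_bochner_integral lborel (F x)
      (of_real (exp (- (\<Sum>i\<in>I. x i))) * mellin_monomial I u x)" for x
    unfolding F_eq[abs_def]
    by (intro has_bochner_integral_mult_left has_bochner_integral_of_real has_bochner_integral_exp_tail)
  have normFv: "has_bochner_integral lborel (\<lambda>v. norm (F x v))
      (exp (- (\<Sum>i\<in>I. x i)) * norm (mellin_monomial I u x))" for x
  proof -
    have "(\<lambda>v. norm (F x v)) = (\<lambda>v. (if (\<Sum>i\<in>I. x i) < v then exp (- v) else 0) * norm (mellin_monomial I u x))"
      by (auto simp: F_eq norm_mult)
    thus ?thesis using has_bochner_integral_mult_left[OF has_bochner_integral_exp_tail] by metis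
  qed
  have G: "has_bochner_integral ?M
      (\<lambda>x. mellin_monomial I u x * of_real (exp (- (\<Sum>i\<in>I. x i)))) (\<Prod>i\<in>I. Gamma (u i))"
    using fin u by (rule has_bochner_integral_Gamma_prod)
  have "integrable (?M \<Otimes>\<^sub>M lborel) (case_prod F)"
  proof (rule Fubini_integrable[OF F_meas])
    have "integrable ?M (\<lambda>x. norm (mellin_monomial I u x * of_real (exp (- (\<Sum>i\<in>I. x i)))))"
      using G by (intro integrable_norm) (simp add: has_bochner_integral_iff)
    thus "integrable ?M (\<lambda>x. \<integral>v. norm (case_prod F (x, v)) \<partial>lborel)"
      using normFv by (simp add: has_bochner_integral_iff norm_mult mult.commute)
    show "AE x in ?M. integrable lborel (\<lambda>v. case_prod F (x, v))"
      using Fv by (simp add: has_bochner_integral_iff)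
  qed
  hence "(\<integral>v. (\<integral>x. F x v \<partial>?M) \<partial>lborel) = (\<integral>x. (\<integral>v. F x v \<partial>lborel) \<partial>?M)"
    by (rule Fubini_integral)
  also have "\<dots> = (\<Prod>i\<in>I. Gamma (u i))"
    using Fv G by (simp add: has_bochner_integral_iff mult.commute)
  also have "(\<lambda>v. \<integral>x. F x v \<partial>?M) = (\<lambda>v. mellin_power (U + 1) v * of_real (exp (- v)) * L)"
  proof
    fix v :: real
    show "(\<integral>x. F x v \<partial>?M) = mellin_power (U + 1) v * of_real (exp (- v)) * L"
    proof (cases "0 < v")
      case True
      thus ?thesis
        using integral_simplex_monomial_homogeneous[where I = I and u = u, OF fin u True]
        by (simp add: F_def mellin_power_def U_def L_def)
    next
      case False
      thus ?thesis by (simp add: F_def simplex_monomial_nonpos[OF fin] mellin_power_def)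
    qed
  qed
  also have "integral\<^sup>L lborel \<dots> = Gamma (U + 1) * L"
    using has_bochner_integral_mult_left[OF has_bochner_integral_Gamma[OF ReU], of L]
    by (simp add: has_bochner_integral_iff)
  finally have "Gamma (U + 1) * L = (\<Prod>i\<in>I. Gamma (u i))" .
  moreover have "U + 1 \<notin> \<int>\<^sub>\<le>\<^sub>0"
    using ReU by (metis Re_complex_of_real le_less_trans less_irrefl nonpos_Ints_cases of_int_0_le_iff
        of_int_le_0_iff of_real_of_int_eq)
  hence "Gamma (U + 1) \<noteq> 0" by (simp add: Gamma_eq_zero_iff)
  ultimately show ?thesis by (simp add: L_def U_def field_simps)
qed

text \<open>
  The unit simplex in the coordinates \<open>insert k I\<close>, sliced along coordinate \<open>k\<close>: the slice at
  height \<open>w\<close> is the simplex of size \<open>1 - w\<close> in the coordinates \<open>I\<close>.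
\<close>

lemma simplex_fibration:
  fixes I :: "'i set"
  assumes fin: "finite I" and k: "k \<notin> I"
    and u: "\<And>i. i \<in> I \<Longrightarrow> Re (u i) > 0" and z: "Re z > 0"
  shows "has_bochner_integral lborel
           (\<lambda>w. mellin_power z w * (LINT x|Pi\<^sub>M I (\<lambda>_. lborel). simplex_monomial I u (1 - w) x))
           (Gamma z * (\<Prod>i\<in>I. Gamma (u i)) / Gamma (z + (\<Sum>i\<in>I. u i) + 1))"
proof -
  let ?M = "Pi\<^sub>M I (\<lambda>_. lborel :: real measure)"
  interpret product_sigma_finite "\<lambda>_::'i. lborel :: real measure"
    by (rule product_sigma_finite_lborel)
  interpret pair_sigma_finite "lborel :: real measure" ?M
    by (rule pair_sigma_finite_PiM_lborel[OF fin])
  define H where "H w x = mellin_power z w * simplex_monomial I u (1 - w) x" for w x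
  define C where "C = (LINT x|?M. norm (simplex_monomial I u 1 x))"
  have H_meas[measurable]: "case_prod H \<in> borel_measurable (lborel \<Otimes>\<^sub>M ?M)"
    unfolding H_def[abs_def] simplex_monomial_def case_prod_beta' by measurable
  have Hx: "integrable ?M (H w)" for w
    unfolding H_def[abs_def] by (intro integrable_mult_right integrable_simplex_monomial fin u)
  \<comment> \<open>Only \<open>0 < w < 1\<close> contributes; there the slice lies in the unit simplex and \<open>1 \<le> exp (1 - w)\<close>.\<close>
  have bound: "(LINT x|?M. norm (H w x)) \<le> norm (mellin_power z w * of_real (exp (- w))) * (exp 1 * C)" for w
  proof (cases "0 < w \<and> w < 1")
    case True
    have "(LINT x|?M. norm (simplex_monomial I u (1 - w) x)) \<le> C"
      unfolding C_def
      by (intro integral_mono integrable_norm integrable_simplex_monomial fin u)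
         (use True in \<open>auto simp: simplex_monomial_def\<close>)
    moreover have "1 \<le> exp (- w) * exp 1" using True by (simp add: exp_add[symmetric])
    ultimately have "1 * (LINT x|?M. norm (simplex_monomial I u (1 - w) x)) \<le> (exp (- w) * exp 1) * C"
      by (intro mult_mono) auto
    thus ?thesis by (simp add: H_def norm_mult mult_left_mono mult.assoc)
  next
    case False
    hence "H w x = 0" for x using simplex_monomial_nonpos[OF fin] by (auto simp: H_def mellin_power_def)
    thus ?thesis by (simp add: C_def)
  qed
  have int: "integrable (lborel \<Otimes>\<^sub>M ?M) (case_prod H)"
  proof (rule Fubini_integrable[OF H_meas])
    show "integrable lborel (\<lambda>w. \<integral>x. norm (case_prod H (w, x)) \<partial>?M)"
    proof (rule Bochner_Integration.integrable_bound)
      show "integrable lborel (\<lambda>w. norm (mellin_power z w * of_real (exp (- w))) * (exp 1 * C))"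
        using has_bochner_integral_Gamma[OF z]
        by (intro integrable_mult_left integrable_norm) (simp add: has_bochner_integral_iff)
      show "(\<lambda>w. \<integral>x. norm (case_prod H (w, x)) \<partial>?M) \<in> borel_measurable lborel" by measurable
      have "0 \<le> C" by (simp add: C_def)
      with bound show "AE w in lborel. norm (\<integral>x. norm (case_prod H (w, x)) \<partial>?M)
          \<le> norm (norm (mellin_power z w * of_real (exp (- w))) * (exp 1 * C))"
        by (simp add: abs_mult)
    qed
    show "AE w in lborel. integrable ?M (\<lambda>x. case_prod H (w, x))" using Hx by simp
  qed
  have Hw: "(\<integral>x. H w x \<partial>?M) = mellin_power z w * (LINT x|?M. simplex_monomial I u (1 - w) x)" for w
    by (simp add: H_def)
  let ?u = "u(k := z)"
  have u': "Re (?u i) > 0" if "i \<in> insert k I" for i using that u z by auto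
  have upd: "simplex_monomial (insert k I) ?u 1 (x(k := w)) = H w x" for x w
  proof -
    have s: "(\<Sum>i\<in>I. (x(k := w)) i) = (\<Sum>i\<in>I. x i)"
      using k by (intro sum.cong) auto
    have m: "(\<Prod>i\<in>I. mellin_power (?u i) ((x(k := w)) i)) = (\<Prod>i\<in>I. mellin_power (u i) (x i))"
      using k by (intro prod.cong) auto
    show ?thesis
      using fin k by (simp add: H_def simplex_monomial_def mellin_monomial_def s m less_diff_eq add.commute
           del: fun_upd_apply) (simp add: s m)
  qed
  have "(\<integral>w. (\<integral>x. H w x \<partial>?M) \<partial>lborel) = (\<integral>x. (\<integral>w. H w x \<partial>lborel) \<partial>?M)"
    by (rule Fubini_integral[OF int, symmetric])
  also have "\<dots> = (LINT x|Pi\<^sub>M (insert k I) (\<lambda>_. lborel). simplex_monomial (insert k I) ?u 1 x)"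
    by (subst product_integral_insert[OF fin k integrable_simplex_monomial[OF _ u']]) (simp_all add: fin upd del: fun_upd_apply)
  also have "\<dots> = (\<Prod>i\<in>insert k I. Gamma (?u i)) / Gamma ((\<Sum>i\<in>insert k I. ?u i) + 1)"
    by (intro integral_unit_simplex_monomial u') (simp add: fin)
  also have "(\<Prod>i\<in>insert k I. Gamma (?u i)) = Gamma z * (\<Prod>i\<in>I. Gamma (u i))"
    using fin k by (auto intro!: prod.cong)
  also have "(\<Sum>i\<in>insert k I. ?u i) = z + (\<Sum>i\<in>I. u i)"
    using fin k by (auto intro!: sum.cong)
  finally show ?thesis
    using integrable_fst[OF int] by (simp add: has_bochner_integral_iff Hw)
qed

section \<open>Integrating by layers\<close>

text \<open>
  For fixed \<open>w\<close> the integrand lives on the simplex \<open>\<Sum> w^(\<gamma> i) x i < 1 - w\<close>. Rescaling it to the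
  standard simplex of size \<open>1 - w\<close> produces the factor \<open>w^(- \<Sum> \<gamma> i u i)\<close>, which turns the
  exponent \<open>\<beta>\<close> into \<open>z\<close>; the slices then fit together to a Dirichlet integral. The index \<open>k\<close>
  serves to name the additional coordinate \<open>w\<close>.
\<close>

lemma has_bochner_integral_layers:
  fixes I :: "'i set" and \<gamma> :: "'i \<Rightarrow> real" and \<beta> :: real
  assumes fin: "finite I" and k: "k \<notin> I"
    and u: "\<And>i. i \<in> I \<Longrightarrow> Re (u i) > 0"
    and z: "z = of_real \<beta> - (\<Sum>i\<in>I. of_real (\<gamma> i) * u i)" "Re z > 0"
  shows "has_bochner_integral (Pi\<^sub>M I (\<lambda>_. lborel))
           (\<lambda>x. LINT w|lborel. (if w + (\<Sum>i\<in>I. x i * w powr \<gamma> i) < 1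
              then mellin_power (of_real \<beta>) w else 0) * mellin_monomial I u x)
           (Gamma z * (\<Prod>i\<in>I. Gamma (u i)) / Gamma (z + (\<Sum>i\<in>I. u i) + 1))"
proof -
  let ?M = "Pi\<^sub>M I (\<lambda>_. lborel :: real measure)"
  interpret pair_sigma_finite "lborel :: real measure" ?M
    by (rule pair_sigma_finite_PiM_lborel[OF fin])
  define G where "G u w x = (if w + (\<Sum>i\<in>I. x i * w powr \<gamma> i) < 1
              then mellin_power (of_real \<beta>) w else 0) * mellin_monomial I u x" for u w x
  have G_meas[measurable]: "case_prod (G u) \<in> borel_measurable (lborel \<Otimes>\<^sub>M ?M)" for u
    unfolding G_def[abs_def] case_prod_beta' by measurable
  have slice: "has_bochner_integral ?M (G u w)
      (mellin_power (of_real \<beta> - (\<Sum>i\<in>I. of_real (\<gamma> i) * u i)) w * (LINT x|?M. simplex_monomial I u (1 - w) x))"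
    if u: "\<And>i. i \<in> I \<Longrightarrow> Re (u i) > 0" for u w
  proof (cases "0 < w")
    case True
    have "G u w = (\<lambda>x. mellin_power (of_real \<beta>) w *
        (if (\<Sum>i\<in>I. w powr \<gamma> i * x i) < 1 - w then mellin_monomial I u x else 0))"
      by (auto simp: G_def algebra_simps)
    moreover have "mellin_power (of_real \<beta>) w * (\<Prod>i\<in>I. of_real (w powr \<gamma> i) powr (- u i))
        = mellin_power (of_real \<beta> - (\<Sum>i\<in>I. of_real (\<gamma> i) * u i)) w"
      using True fin
      by (simp add: mellin_power_exp powr_def[of "of_real _ :: complex"] Ln_of_real exp_sum[symmetric]
          exp_add[symmetric] sum_distrib_left sum_negf algebra_simps)
    ultimately show ?thesis
      using has_bochner_integral_mult_right[OF has_bochner_integral_scaled_simplex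
            [where I = I and u = u and c = "\<lambda>i. w powr \<gamma> i" and t = "1 - w", OF fin u],
          of "mellin_power (of_real \<beta>) w"] True
      by (simp add: mult.assoc[symmetric])
  next
    case False
    hence "G u w = (\<lambda>_. 0)" by (auto simp: G_def mellin_power_def)
    with False show ?thesis by (simp add: mellin_power_def has_bochner_integral_zero)
  qed
  \<comment> \<open>The parameter \<open>u\<close> of \<open>G\<close> varies because the modulus of \<open>G u\<close> is \<open>G\<close> at the real parts of \<open>u\<close>.\<close>
  have normG: "complex_of_real (norm (G u w x)) = G (\<lambda>i. of_real (Re (u i))) w x" for w x
    by (simp add: G_def norm_mult norm_mellin_power norm_mellin_monomial)
  let ?u = "\<lambda>i. complex_of_real (Re (u i))"
  have int: "integrable (lborel \<Otimes>\<^sub>M ?M) (case_prod (G u))"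
  proof (rule Fubini_integrable[OF G_meas])
    have u': "\<And>i. i \<in> I \<Longrightarrow> Re (?u i) > 0" using u by simp
    have z': "of_real \<beta> - (\<Sum>i\<in>I. of_real (\<gamma> i) * ?u i) = of_real (Re z)"
      by (simp add: z(1))
    have "of_real (\<integral>x. norm (G u w x) \<partial>?M)
        = mellin_power (of_real (Re z)) w * (LINT x|?M. simplex_monomial I ?u (1 - w) x)" for w
      using slice[where u = ?u and w = w, OF u'] unfolding z'
      by (simp add: integral_complex_of_real[symmetric] normG has_bochner_integral_iff)
    hence "integrable lborel (\<lambda>w. complex_of_real (\<integral>x. norm (G u w x) \<partial>?M))"
      using simplex_fibration[where I = I and u = ?u and z = "of_real (Re z)", OF fin k u'] z(2)
      by (simp add: has_bochner_integral_iff)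
    thus "integrable lborel (\<lambda>w. \<integral>x. norm (case_prod (G u) (w, x)) \<partial>?M)"
      by (simp add: complex_of_real_integrable_eq)
    show "AE w in lborel. integrable ?M (\<lambda>x. case_prod (G u) (w, x))"
      using slice[where u = u, OF u] by (simp add: has_bochner_integral_iff)
  qed
  have "(\<integral>x. (\<integral>w. G u w x \<partial>lborel) \<partial>?M) = (\<integral>w. (\<integral>x. G u w x \<partial>?M) \<partial>lborel)"
    by (rule Fubini_integral[OF int])
  also have "\<dots> = Gamma z * (\<Prod>i\<in>I. Gamma (u i)) / Gamma (z + (\<Sum>i\<in>I. u i) + 1)"
    using slice[where u = u, OF u] simplex_fibration[where I = I and u = u, OF fin k u z(2)]
    by (simp add: has_bochner_integral_iff z(1))
  finally show ?thesis
    using integrable_snd[OF int] by (simp add: has_bochner_integral_iff G_def)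
qed

section \<open>Positivity of the principal solution\<close>

text \<open>
  Along the ray through \<open>x\<close> the terms of the local power series grow with the distance to the
  centre, so their moduli at the outermost point form a convergent majorant.
\<close>

lemma analytic_on_orthant_continuous_on_ray:
  assumes Z: "analytic_on_orthant p Z" and x: "x \<in> orthant p"
  shows "continuous_on {0..} (\<lambda>t. Z (\<lambda>i\<in>{1..p}. t * x i))"
proof (unfold continuous_on_eq_continuous_within, intro ballI)
  fix t0 :: real
  assume "t0 \<in> {0..}"
  hence t0: "0 \<le> t0" by simp
  have x0: "0 \<le> x i" if "i \<in> {1..p}" for i using x that by (auto simp: orthant_def)
  let ?a = "\<lambda>i\<in>{1..p}. t0 * x i"
  have "?a \<in> orthant p" using t0 x0 by (auto simp: orthant_def)
  hence "\<exists>c r. r > 0 \<and> (\<forall>y\<in>real_space p. (\<forall>i\<in>{1..p}. \<bar>y i - ?a i\<bar> < r) \<longrightarrow>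
      (\<lambda>m. c m * (\<Prod>i=1..p. of_real (y i - ?a i) ^ m i)) summable_on multi_indices p \<and>
      (y \<in> orthant p \<longrightarrow> ((\<lambda>m. c m * (\<Prod>i=1..p. of_real (y i - ?a i) ^ m i)) has_sum Z y)
        (multi_indices p)))"
    using Z unfolding analytic_on_orthant_def by (rule bspec[rotated])
  then obtain c r where r: "r > 0" and
    ser: "\<forall>y\<in>real_space p. (\<forall>i\<in>{1..p}. \<bar>y i - ?a i\<bar> < r) \<longrightarrow>
      (\<lambda>m. c m * (\<Prod>i=1..p. of_real (y i - ?a i) ^ m i)) summable_on multi_indices p \<and>
      (y \<in> orthant p \<longrightarrow> ((\<lambda>m. c m * (\<Prod>i=1..p. of_real (y i - ?a i) ^ m i)) has_sum Z y)
        (multi_indices p))"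
    by (elim exE conjE)
  \<comment> \<open>\<open>B\<close> exceeds every coordinate of \<open>x\<close>, so parameters within \<open>\<delta>\<close> of \<open>t0\<close> stay in the polydisc;
      the point at \<open>t0 + \<delta>\<close> is the one that supplies the majorant.\<close>
  define B where "B = 1 + (\<Sum>i=1..p. x i)"
  have B: "B > 0" unfolding B_def by (intro add_pos_nonneg sum_nonneg x0) auto
  have xB: "x i < B" if "i \<in> {1..p}" for i
    using member_le_sum[of i "{1..p}" x] x0 that by (simp add: B_def)
  define \<delta> where "\<delta> = r / B"
  have \<delta>: "\<delta> > 0" using r B by (simp add: \<delta>_def)
  let ?y = "\<lambda>s. \<lambda>i\<in>{1..p}. s * x i"
  have near: "\<forall>i\<in>{1..p}. \<bar>?y s i - ?a i\<bar> < r" if s: "\<bar>s - t0\<bar> \<le> \<delta>" for s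
  proof
    fix i assume i: "i \<in> {1..p}"
    have "\<bar>s - t0\<bar> * x i \<le> \<delta> * x i" using s x0[OF i] by (intro mult_right_mono)
    also have "\<dots> < \<delta> * B" using \<delta> xB[OF i] by simp
    finally show "\<bar>?y s i - ?a i\<bar> < r"
      using i x0[OF i] B by (simp add: \<delta>_def abs_mult left_diff_distrib[symmetric])
  qed
  have rs: "?y s \<in> real_space p" for s by (auto simp: real_space_def)
  define f where "f m s = c m * (\<Prod>i=1..p. of_real ((s - t0) * x i) ^ m i)" for m s
  have f_eq: "c m * (\<Prod>i=1..p. of_real (?y s i - ?a i) ^ m i) = f m s" for m s
    unfolding f_def by (intro arg_cong2[where f = "(*)"] prod.cong) (auto simp: left_diff_distrib)
  define Y where "Y = {0..} \<inter> ball t0 \<delta>"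
  have "uniform_limit Y (\<lambda>X s. \<Sum>m\<in>X. f m s) (\<lambda>s. Z (?y s)) (finite_subsets_at_top (multi_indices p))"
  proof (rule Weierstrass_m_test_general')
    show "norm (f m s) \<le> norm (f m (t0 + \<delta>))" if "s \<in> Y" for m s
      using that x0 \<delta> unfolding f_def norm_mult prod_norm[symmetric] norm_power norm_of_real
      by (intro mult_left_mono prod_mono conjI power_mono zero_le_power)
         (auto simp: abs_mult Y_def dist_real_def mult_right_mono)
    show "((\<lambda>m. f m s) has_sum Z (?y s)) (multi_indices p)" if "s \<in> Y" for s
    proof -
      have s: "0 \<le> s" "\<bar>s - t0\<bar> \<le> \<delta>" using that by (auto simp: Y_def dist_real_def)
      hence "?y s \<in> orthant p" using x0 by (auto simp: orthant_def)
      thus ?thesis using ser[THEN bspec, THEN mp, OF rs near, of s] s(2) unfolding f_eq by blast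
    qed
    show "(\<lambda>m. norm (f m (t0 + \<delta>))) summable_on multi_indices p"
      using ser[THEN bspec, THEN mp, OF rs near, of "t0 + \<delta>"] \<delta> unfolding f_eq
      by (simp add: summable_on_iff_abs_summable_on_complex)
  qed
  hence "continuous_on Y (\<lambda>s. Z (?y s))"
    by (rule uniform_limit_theorem[rotated])
       (auto intro!: always_eventually continuous_intros simp: f_def)
  hence "continuous (at t0 within Y) (\<lambda>s. Z (?y s))"
    using t0 \<delta> by (auto simp: continuous_on_eq_continuous_within Y_def)
  also have "at t0 within Y = at t0 within {0..}"
    by (rule at_within_nhd[of _ "ball t0 \<delta>"]) (use \<delta> in \<open>auto simp: Y_def\<close>)
  finally show "continuous (at t0 within {0..}) (\<lambda>s. Z (?y s))" .
qed

text \<open>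
  Along the ray from the origin to \<open>x\<close> the solution starts at 1 and never vanishes. Wherever it is a
  positive real, it is a simple root, since the derivative of the polynomial is positive there. A
  nearby non-real value would, together with its conjugate, give two distinct roots merging into that
  simple root, which is impossible. So having a nonnegative real value is a locally constant property
  along the ray, and it holds at the origin.
\<close>

lemma principal_solution_positive_root:
  assumes Z: "principal_solution p n ns Z" and n: "0 < n" and ns: "\<And>i. i \<in> {1..p} \<Longrightarrow> 0 < ns i"
    and x: "x \<in> orthant p"
  obtains \<rho> :: real where "\<rho> > 0" "Z x = of_real \<rho>" "\<rho> ^ n + (\<Sum>i=1..p. x i * \<rho> ^ ns i) = 1"
proof -
  have x0: "0 \<le> x i" if "i \<in> {1..p}" for i using x that by (auto simp: orthant_def)
  define \<zeta> where "\<zeta> t = Z (\<lambda>i\<in>{1..p}. t * x i)" for t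
  have \<zeta>0: "\<zeta> 0 = 1" using Z by (simp add: \<zeta>_def principal_solution_def)
  have "(\<lambda>i\<in>{1..p}. 1 * x i) = x"
    using x by (auto simp: orthant_def PiE_def extensional_def)
  hence \<zeta>1: "\<zeta> 1 = Z x" by (simp add: \<zeta>_def)
  have cont: "continuous_on {0..} \<zeta>"
    using Z x analytic_on_orthant_continuous_on_ray unfolding \<zeta>_def principal_solution_def by blast
  have root: "\<zeta> t ^ n + (\<Sum>i=1..p. of_real (t * x i) * \<zeta> t ^ ns i) = 1" if "0 \<le> t" for t
  proof -
    have "(\<lambda>i\<in>{1..p}. t * x i) \<in> orthant p" using x0 that by (auto simp: orthant_def)
    hence "\<zeta> t ^ n + (\<Sum>i=1..p. of_real ((\<lambda>i\<in>{1..p}. t * x i) i) * \<zeta> t ^ ns i) - 1 = 0"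
      using Z unfolding principal_solution_def \<zeta>_def by blast
    thus ?thesis by simp
  qed
  have nz: "\<zeta> t \<noteq> 0" if "0 \<le> t" for t
  proof
    assume "\<zeta> t = 0"
    moreover have "(\<Sum>i=1..p. of_real (t * x i) * (0::complex) ^ ns i) = 0"
      using ns by (intro sum.neutral) auto
    ultimately show False using root[OF that] n by (simp add: zero_power)
  qed
  \<comment> \<open>The difference quotient of the polynomial at \<open>z\<close> and \<open>w\<close>; at \<open>z = w\<close> it is the derivative.\<close>
  define Q where "Q z w s = (\<Sum>k<n. w ^ (n - Suc k) * z ^ k)
      + (\<Sum>i=1..p. of_real (s * x i) * (\<Sum>k<ns i. w ^ (ns i - Suc k) * z ^ k))" for z w :: complex and s
  have factor: "(z ^ n + (\<Sum>i=1..p. of_real (s * x i) * z ^ ns i))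
      - (w ^ n + (\<Sum>i=1..p. of_real (s * x i) * w ^ ns i)) = (z - w) * Q z w s" for z w s
  proof -
    have "(z ^ n + (\<Sum>i=1..p. of_real (s * x i) * z ^ ns i))
        - (w ^ n + (\<Sum>i=1..p. of_real (s * x i) * w ^ ns i))
        = (z ^ n - w ^ n) + (\<Sum>i=1..p. of_real (s * x i) * (z ^ ns i - w ^ ns i))"
      by (simp add: right_diff_distrib sum_subtractf)
    thus ?thesis
      by (simp add: Q_def power_diff_sumr2[of z _ w] distrib_left sum_distrib_left mult.left_commute)
  qed
  have "(\<zeta> 0 \<in> \<real>\<^sub>\<ge>\<^sub>0) = (\<zeta> 1 \<in> \<real>\<^sub>\<ge>\<^sub>0)"
  proof (rule connected_local_const[of "{0..}" _ _ "\<lambda>t. \<zeta> t \<in> \<real>\<^sub>\<ge>\<^sub>0"])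
    show "connected {0::real..}" by (simp add: convex_connected)
    show "\<forall>t\<in>{0..}. \<forall>\<^sub>F s in at t within {0..}. (\<zeta> t \<in> \<real>\<^sub>\<ge>\<^sub>0) = (\<zeta> s \<in> \<real>\<^sub>\<ge>\<^sub>0)"
    proof
      fix t :: real
      assume t: "t \<in> {0..}"
      let ?F = "at t within {0..}"
      have lim: "(\<zeta> \<longlongrightarrow> \<zeta> t) ?F" using cont t by (simp add: continuous_on_def)
      show "\<forall>\<^sub>F s in ?F. (\<zeta> t \<in> \<real>\<^sub>\<ge>\<^sub>0) = (\<zeta> s \<in> \<real>\<^sub>\<ge>\<^sub>0)"
      proof (cases "\<zeta> t \<in> \<real>\<^sub>\<ge>\<^sub>0")
        case False
        hence "\<forall>\<^sub>F s in ?F. \<zeta> s \<in> - \<real>\<^sub>\<ge>\<^sub>0"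
          by (intro topological_tendstoD[OF lim]) (auto simp: open_Compl)
        thus ?thesis by eventually_elim (use False in simp)
      next
        case True
        define \<rho> where "\<rho> = Re (\<zeta> t)"
        have \<rho>: "\<zeta> t = of_real \<rho>" "\<rho> > 0"
          using True nz[of t] t by (auto simp: \<rho>_def complex_nonneg_Reals_iff complex_eq_iff)
        have "0 < (\<Sum>k<n. \<rho> ^ (n - Suc k) * \<rho> ^ k)"
          using n \<rho> by (intro sum_pos) auto
        moreover have "0 \<le> (\<Sum>i=1..p. (t * x i) * (\<Sum>k<ns i. \<rho> ^ (ns i - Suc k) * \<rho> ^ k))"
          using \<rho> t x0 by (intro sum_nonneg mult_nonneg_nonneg) auto
        moreover have "Q (\<zeta> t) (cnj (\<zeta> t)) t = of_real ((\<Sum>k<n. \<rho> ^ (n - Suc k) * \<rho> ^ k)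
            + (\<Sum>i=1..p. (t * x i) * (\<Sum>k<ns i. \<rho> ^ (ns i - Suc k) * \<rho> ^ k)))"
          by (simp add: Q_def \<rho>(1))
        ultimately have Qpos: "0 < Re (Q (\<zeta> t) (cnj (\<zeta> t)) t)" by simp
        have "((\<lambda>s. Re (Q (\<zeta> s) (cnj (\<zeta> s)) s)) \<longlongrightarrow> Re (Q (\<zeta> t) (cnj (\<zeta> t)) t)) ?F"
          unfolding Q_def by (intro tendsto_intros lim)
        hence "\<forall>\<^sub>F s in ?F. 0 < Re (Q (\<zeta> s) (cnj (\<zeta> s)) s)"
          using Qpos by (rule order_tendstoD)
        moreover have "\<forall>\<^sub>F s in ?F. 0 < Re (\<zeta> s)"
          using tendsto_Re[OF lim] by (rule order_tendstoD) (simp add: \<rho>)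
        moreover have "\<forall>\<^sub>F s in ?F. s \<in> {0..}" by (simp add: eventually_at_filter)
        ultimately show ?thesis
        proof eventually_elim
          case (elim s)
          have r: "\<zeta> s ^ n + (\<Sum>i=1..p. of_real (s * x i) * \<zeta> s ^ ns i) = 1"
            using elim by (intro root) simp
          hence "cnj (\<zeta> s) ^ n + (\<Sum>i=1..p. of_real (s * x i) * cnj (\<zeta> s) ^ ns i) = 1"
            by (auto dest: arg_cong[of _ _ cnj])
          with r have "(\<zeta> s - cnj (\<zeta> s)) * Q (\<zeta> s) (cnj (\<zeta> s)) s = 0"
            by (subst factor[symmetric]) simp
          with elim have "\<zeta> s = cnj (\<zeta> s)" by auto
          with elim True show ?case
            by (auto simp: complex_nonneg_Reals_iff complex_eq_iff)
        qed
      qed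
    qed
  qed simp_all
  hence "Z x \<in> \<real>\<^sub>\<ge>\<^sub>0" by (simp add: \<zeta>0 \<zeta>1)
  moreover have "Z x \<noteq> 0" using nz[of 1] \<zeta>1 by simp
  ultimately obtain \<rho> where \<rho>: "Z x = of_real \<rho>" "\<rho> > 0"
    by (auto elim!: nonneg_Reals_cases)
  have "complex_of_real (\<rho> ^ n + (\<Sum>i=1..p. x i * \<rho> ^ ns i)) = of_real 1"
    using root[of 1] by (simp add: \<zeta>1 \<rho>)
  hence "\<rho> ^ n + (\<Sum>i=1..p. x i * \<rho> ^ ns i) = 1" by (simp only: of_real_eq_iff)
  with \<rho> show ?thesis by (intro that)
qed

section \<open>The integral of a power of the principal solution\<close>

theorem lemma4:
  fixes p n :: nat and ns :: "nat \<Rightarrow> nat"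
    and Z :: "(nat \<Rightarrow> real) \<Rightarrow> complex"
    and \<alpha> :: real and u :: "nat \<Rightarrow> complex" and u0 :: complex
  assumes "p \<ge> 1"
    and "0 < ns p"
    and "\<And>i j. 1 \<le> i \<Longrightarrow> i < j \<Longrightarrow> j \<le> p \<Longrightarrow> ns j < ns i"
    and "ns 1 < n"
    and "principal_solution p n ns Z"
    and "\<alpha> > 0"
    and "u0 = of_real \<alpha> / of_nat n - (\<Sum>i=1..p. of_nat (ns i) / of_nat n * u i)"
    and "Re u0 > 0"
    and "\<And>i. i \<in> {1..p} \<Longrightarrow> Re (u i) > 0"
  shows "set_integrable (Pi\<^sub>M {1..p} (\<lambda>_. lborel)) (orthant p)
           (\<lambda>x. Z x powr of_real \<alpha> * (\<Prod>i=1..p. of_real (x i) powr (u i - 1)))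
       \<and> (LINT x:orthant p|Pi\<^sub>M {1..p} (\<lambda>_. lborel).
            Z x powr of_real \<alpha> * (\<Prod>i=1..p. of_real (x i) powr (u i - 1)))
         = of_real \<alpha> / of_nat n *
           (Gamma u0 * (\<Prod>i=1..p. Gamma (u i)) / Gamma (u0 + (\<Sum>i=1..p. u i) + 1))"
proof -
  let ?M = "Pi\<^sub>M {1..p} (\<lambda>_. lborel :: real measure)"
  let ?I = "\<lambda>x. Z x powr of_real \<alpha> * (\<Prod>i=1..p. of_real (x i) powr (u i - 1))"
  let ?V = "Gamma u0 * (\<Prod>i=1..p. Gamma (u i)) / Gamma (u0 + (\<Sum>i=1..p. u i) + 1)"
  have n: "0 < n" using assms(4) by simp
  have ns: "0 < ns i" if "i \<in> {1..p}" for i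
    using assms(2) assms(3)[of i p] that by (cases "i = p") auto
  define \<beta> where "\<beta> = \<alpha> / real n"
  define \<gamma> where "\<gamma> i = real (ns i) / real n" for i
  have \<beta>: "\<beta> > 0" using assms(6) n by (simp add: \<beta>_def)
  \<comment> \<open>\<open>J\<close> is the given integrand with the power of \<open>Z\<close> replaced by its layers, up to the factor \<open>\<beta>\<close>.\<close>
  define J where "J x = (LINT w|lborel. (if w + (\<Sum>i=1..p. x i * w powr \<gamma> i) < 1
              then mellin_power (of_real \<beta>) w else 0) * mellin_monomial {1..p} u x)" for x
  have J: "has_bochner_integral ?M J ?V"
    unfolding J_def
    by (rule has_bochner_integral_layers[where k = 0])
       (use assms(7-9) in \<open>simp_all add: \<beta>_def \<gamma>_def\<close>)
  have J_eq: "indicator (orthant p) x *\<^sub>R ?I x = of_real \<beta> * J x" if xM: "x \<in> space ?M" for x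
  proof (cases "x \<in> orthant p")
    case False
    then obtain i where "i \<in> {1..p}" "x i < 0"
      using xM by (force simp: orthant_def space_PiM PiE_iff not_le)
    hence "mellin_monomial {1..p} u x = 0" by (intro mellin_monomial_eq_0[of _ i]) auto
    with False show ?thesis by (simp add: J_def)
  next
    case True
    obtain \<rho> where \<rho>: "\<rho> > 0" "Z x = of_real \<rho>" "\<rho> ^ n + (\<Sum>i=1..p. x i * \<rho> ^ ns i) = 1"
      using principal_solution_positive_root[OF assms(5) n ns True] by blast
    have x0: "0 \<le> x i" if "i \<in> {1..p}" for i using True that by (auto simp: orthant_def)
    \<comment> \<open>Increasing with slope at least 1, hence strictly, even where all \<open>x i\<close> vanish.\<close>
    have mono: "w + (\<Sum>i=1..p. x i * w powr \<gamma> i) \<le> v + (\<Sum>i=1..p. x i * v powr \<gamma> i) - (v - w)"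
      if "0 < w" "w \<le> v" for w v
      using that x0 n by (auto intro!: sum_mono mult_left_mono powr_mono2 simp: \<gamma>_def)
    have "(\<rho> ^ n) powr \<gamma> i = \<rho> ^ ns i" for i
      using \<rho>(1) n by (simp add: \<gamma>_def powr_realpow[symmetric] powr_powr)
    hence one: "\<rho> ^ n + (\<Sum>i=1..p. x i * (\<rho> ^ n) powr \<gamma> i) = 1" using \<rho>(3) by simp
    have iff: "w + (\<Sum>i=1..p. x i * w powr \<gamma> i) < 1 \<longleftrightarrow> w < \<rho> ^ n" if "0 < w" for w
      using mono[of w "\<rho> ^ n"] mono[of "\<rho> ^ n" w] one that \<rho>(1) by (smt (verit) zero_less_power)
    have layers: "(\<lambda>w. if w + (\<Sum>i=1..p. x i * w powr \<gamma> i) < 1 then mellin_power (of_real \<beta>) w else 0)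
        = (\<lambda>w. if w < \<rho> ^ n then mellin_power (of_real \<beta>) w else 0)"
      using iff by (auto simp: mellin_power_def)
    have "J x = of_real ((\<rho> ^ n) powr \<beta> / \<beta>) * mellin_monomial {1..p} u x"
      using has_bochner_integral_mult_left[OF has_bochner_integral_mellin_power_cutoff[OF \<beta>, of "\<rho> ^ n"]] \<rho>(1)
      unfolding J_def layers[THEN fun_cong] by (simp add: has_bochner_integral_iff)
    also have "(\<rho> ^ n) powr \<beta> = \<rho> powr \<alpha>"
      using \<rho>(1) n by (simp add: \<beta>_def powr_realpow[symmetric] powr_powr)
    \<comment> \<open>At a vanishing coordinate both sides are zero, because \<open>0 powr z = 0\<close>.\<close>
    also have "mellin_monomial {1..p} u x = (\<Prod>i=1..p. of_real (x i) powr (u i - 1))"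
    proof -
      have "mellin_power (u i) (x i) = of_real (x i) powr (u i - 1)" if "i \<in> {1..p}" for i
        using x0[OF that] by (cases "x i = 0") (auto simp: mellin_power_def)
      thus ?thesis unfolding mellin_monomial_def by (rule prod.cong[OF refl])
    qed
    finally show ?thesis
      using True \<beta> \<rho> by (simp add: powr_of_real)
  qed
  have "has_bochner_integral ?M (\<lambda>x. of_real \<beta> * J x) (of_real \<beta> * ?V)"
    by (intro has_bochner_integral_mult_right J)
  hence "has_bochner_integral ?M (\<lambda>x. indicator (orthant p) x *\<^sub>R ?I x) (of_real \<beta> * ?V)"
    by (subst has_bochner_integral_cong[OF refl J_eq refl])
  thus ?thesis
    by (simp add: has_bochner_integral_iff set_integrable_def set_lebesgue_integral_def \<beta>_def)
qed

end
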